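(* For any integer $k$, the elliptic curve $E_k$ given by the Weierstrass equation $$Y^2 - kXY = X^3 - (k^2+5)$$ has no integral point.
   Context: An integral point of $E_k$ means an affine point with integer coordinates on the given Weierstrass equation, i.e. a pair $(X,Y) = (a,b) \in \mathbb{Z}^2$ with $b^2 - kab = a^3 - (k^2+5)$. *)

theory Defs
  imports Main
begin

record weierstrass_eqn =
  coeff_a1 :: int
  coeff_a2 :: int
  coeff_a3 :: int
  coeff_a4 :: int
  coeff_a6 :: int

definition integral_points :: "weierstrass_eqn \<Rightarrow> (int \<times> int) set" where
  "integral_points W = {(x, y).
     y\<^sup>2 + coeff_a1 W * x * y + coeff_a3 W * y
       = x^3 + coeff_a2 W * x\<^sup>2 + coeff_a4 W * x + coeff_a6 W}"

definition discriminant :: "weierstrass_eqn \<Rightarrow> int" where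
  "discriminant W =
    (let a1 = coeff_a1 W; a2 = coeff_a2 W; a3 = coeff_a3 W; a4 = coeff_a4 W; a6 = coeff_a6 W;
         b2 = a1\<^sup>2 + 4 * a2;
         b4 = 2 * a4 + a1 * a3;
         b6 = a3\<^sup>2 + 4 * a6;
         b8 = a1\<^sup>2 * a6 + 4 * a2 * a6 - a1 * a3 * a4 + a2 * a3\<^sup>2 - a4\<^sup>2
     in - (b2\<^sup>2) * b8 - 8 * b4^3 - 27 * b6\<^sup>2 + 9 * b2 * b4 * b6)"

text \<open>A Weierstrass equation defines an elliptic curve over the rationals iff it is nonsingular,
  that is, iff its discriminant does not vanish.\<close>

definition is_elliptic :: "weierstrass_eqn \<Rightarrow> bool" where
  "is_elliptic W \<longleftrightarrow> discriminant W \<noteq> 0"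

definition E :: "int \<Rightarrow> weierstrass_eqn" where
  "E k = \<lparr>coeff_a1 = - k, coeff_a2 = 0, coeff_a3 = 0, coeff_a4 = 0, coeff_a6 = - (k\<^sup>2 + 5)\<rparr>"

lemma integral_points_E_iff:
  "(a, b) \<in> integral_points (E k) \<longleftrightarrow> b\<^sup>2 - k * a * b = a^3 - (k\<^sup>2 + 5)"
  by (simp add: integral_points_def E_def algebra_simps)

lemma discriminant_E: "discriminant (E k) = (k\<^sup>2 + 5) * (k^6 - 432 * (k\<^sup>2 + 5))"
  by (simp add: discriminant_def E_def Let_def algebra_simps power_numeral_reduce)

lemma is_elliptic_E: "is_elliptic (E k)"
proof -
  define t where "t = \<bar>k\<bar>"
  have t0: "t \<ge> 0" and sq: "k\<^sup>2 = t\<^sup>2" by (simp_all add: t_def)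
  have k6: "k^6 = t\<^sup>2 * t\<^sup>2 * t\<^sup>2"
    unfolding sq[symmetric] by (simp flip: power_add)
  have "t\<^sup>2 * t\<^sup>2 * t\<^sup>2 \<noteq> 432 * (t\<^sup>2 + 5)"
  proof (cases "t \<le> 4")
    case True
    with t0 have "t \<in> {0, 1, 2, 3, 4}" by auto
    then show ?thesis by auto
  next
    case False
    then have "t\<^sup>2 \<ge> 25"
      using power_mono[of 5 t 2] by simp
    then have "t\<^sup>2 * t\<^sup>2 \<ge> 25 * 25"
      by (intro mult_mono) auto
    then have "t\<^sup>2 * t\<^sup>2 * t\<^sup>2 \<ge> 25 * 25 * t\<^sup>2"
      by (intro mult_right_mono) auto
    moreover have "25 * 25 * t\<^sup>2 > 432 * (t\<^sup>2 + 5)"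
      using \<open>t\<^sup>2 \<ge> 25\<close> by simp
    ultimately show ?thesis by linarith
  qed
  moreover have "k\<^sup>2 + 5 \<noteq> 0"
    using zero_le_power2[of k] by linarith
  ultimately show ?thesis
    by (simp add: is_elliptic_def discriminant_E k6 sq)
qed

end

theory Submission
  imports Defs "HOL-Number_Theory.Quadratic_Reciprocity"
begin

text \<open>By quadratic reciprocity, 3 is a square modulo a prime \<open>p > 3\<close> only if \<open>p \<equiv> \<plusminus>1 (mod 12)\<close>, so
  every divisor of \<open>x\<^sup>2 - 3\<close> prime to 6 is \<open>\<plusminus>1\<close> modulo 12. An integral point \<open>(a, b)\<close> of \<open>E k\<close> satisfies
  \<open>a \<equiv> 1 (mod 4)\<close> and \<open>(b - k)\<^sup>2 \<equiv> 3 (mod a - 2)\<close>. If 3 does not divide \<open>a - 2\<close>, then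
  \<open>a - 2 \<equiv> -1 (mod 12)\<close>, so \<open>a \<equiv> 1 (mod 3)\<close> and the equation makes 2 a square modulo 3. If
  \<open>a = 3 m + 2\<close>, then the equation modulo 9 gives \<open>m \<equiv> 2 (mod 3)\<close>, whereas \<open>m \<equiv> 1 (mod 4)\<close> and
  \<open>m \<equiv> \<plusminus>1 (mod 12)\<close> give \<open>m \<equiv> 1 (mod 12)\<close>.\<close>

definition cong_pm1 :: "int \<Rightarrow> int \<Rightarrow> bool"
  where "cong_pm1 m a \<longleftrightarrow> [a = 1] (mod m) \<or> [a = - 1] (mod m)"

lemma cong_pm1_mult:
  assumes "cong_pm1 m a" "cong_pm1 m b"
  shows "cong_pm1 m (a * b)"
proof -
  have "[a * b = s * t] (mod m)" if "[a = s] (mod m)" "[b = t] (mod m)" for s t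
    using that by (rule cong_mult)
  from this[of 1 1] this[of 1 "- 1"] this[of "- 1" 1] this[of "- 1" "- 1"] assms
  show ?thesis by (auto simp: cong_pm1_def)
qed

lemma cong_pm1_if_prime_divisors:
  assumes "n \<noteq> 0" "\<And>p. prime p \<Longrightarrow> p dvd n \<Longrightarrow> cong_pm1 m p"
  shows "cong_pm1 m n"
  using assms
proof (induction n rule: prime_divisors_induct)
  case (unit u)
  then have "u = 1 \<or> u = - 1" by auto
  then show ?case by (auto simp: cong_pm1_def)
next
  case (factor p n)
  then show ?case by (simp add: cong_pm1_mult)
qed simp

lemma coprime_6_iff: "coprime d 6 \<longleftrightarrow> odd d \<and> \<not> 3 dvd d" for d :: int
proof -
  have "coprime d (2 * 3) \<longleftrightarrow> coprime 2 d \<and> coprime 3 d"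
    by (simp only: coprime_mult_right_iff coprime_commute)
  also have "coprime 3 d \<longleftrightarrow> \<not> 3 dvd d"
    using prime_imp_coprime[of 3 d] coprime_absorb_left[of 3 d] by auto
  finally show ?thesis by simp
qed

lemma cong_pm1_12_iff:
  assumes "coprime a 6"
  shows "cong_pm1 12 a \<longleftrightarrow> ([a = 1] (mod 3) \<longleftrightarrow> [a = 1] (mod 4))"
proof -
  define r where "r = a mod 12"
  have "odd r" "\<not> 3 dvd r"
    using assms by (simp_all add: coprime_6_iff r_def dvd_mod_iff)
  moreover have "0 \<le> r" "r < 12"
    by (simp_all add: r_def)
  ultimately have "r \<in> {1, 5, 7, 11}"
    by simp presburger
  moreover have "a mod 3 = r mod 3" "a mod 4 = r mod 4"
    by (simp_all add: r_def mod_mod_cancel)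
  ultimately show ?thesis
    by (auto simp: cong_pm1_def cong_def simp flip: r_def)
qed

lemma QuadRes_mod_3_iff: "QuadRes 3 a \<longleftrightarrow> \<not> [a = 2] (mod 3)"
proof
  assume "QuadRes 3 a"
  then obtain y where "[y\<^sup>2 = a] (mod 3)" by (auto simp: QuadRes_def)
  moreover have "y mod 3 = 0 \<or> y mod 3 = 1 \<or> y mod 3 = 2" by presburger
  then have "y\<^sup>2 mod 3 \<noteq> 2" using power_mod[of y 3 2] by auto
  ultimately show "\<not> [a = 2] (mod 3)" by (simp add: cong_def)
next
  assume "\<not> [a = 2] (mod 3)"
  then have "[0\<^sup>2 = a] (mod 3) \<or> [1\<^sup>2 = a] (mod 3)"
    unfolding cong_iff_dvd_diff by simp presburger
  then show "QuadRes 3 a" unfolding QuadRes_def by blast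
qed

lemma QuadRes_3_iff_cong_pm1_12:
  fixes p :: nat
  assumes "prime p" "p > 3"
  shows "QuadRes (int p) 3 \<longleftrightarrow> cong_pm1 12 (int p)"
proof -
  have "odd p" "\<not> 3 dvd p"
    using assms prime_odd_nat[of p] primes_dvd_imp_eq[of 3 p] by auto
  then have coprime_p_6: "coprime (int p) 6"
    using int_dvd_int_iff[of 3 p] by (simp add: coprime_6_iff)
  have "\<not> int p dvd 3"
    using assms zdvd_imp_le[of "int p" 3] by auto
  then have "QuadRes (int p) 3 \<longleftrightarrow> Legendre 3 (int p) = 1"
    by (simp add: Legendre_def cong_0_iff)
  moreover have "Legendre (int p) 3 = (if [int p = 1] (mod 3) then 1 else - 1)"
    using coprime_p_6 unfolding Legendre_def QuadRes_mod_3_iff coprime_6_iff cong_iff_dvd_diff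
    by simp presburger
  moreover have "Legendre (int p) 3 * Legendre 3 (int p) = (- 1) ^ ((p - 1) div 2)"
    using Quadratic_Reciprocity[of p 3] assms by simp
  moreover have "even ((p - 1) div 2) \<longleftrightarrow> [int p = 1] (mod 4)"
    using \<open>odd p\<close> unfolding cong_iff_dvd_diff by presburger
  ultimately have "QuadRes (int p) 3 \<longleftrightarrow> ([int p = 1] (mod 3) \<longleftrightarrow> [int p = 1] (mod 4))"
    by (auto simp: minus_one_power_iff split: if_splits)
  also have "\<dots> \<longleftrightarrow> cong_pm1 12 (int p)"
    using coprime_p_6 by (simp only: cong_pm1_12_iff)
  finally show ?thesis .
qed

lemma cong_pm1_12_if_dvd_square_minus_3:
  fixes d x :: int
  assumes "d dvd x\<^sup>2 - 3" "coprime d 6"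
  shows "cong_pm1 12 d"
proof (rule cong_pm1_if_prime_divisors)
  show "d \<noteq> 0" using assms(2) by auto
next
  fix p :: int
  assume "prime p" "p dvd d"
  have "\<not> p dvd 6"
    using \<open>prime p\<close> \<open>p dvd d\<close> assms(2) coprime_common_divisor not_prime_unit by blast
  then have "p \<notin> {2, 3}" by auto
  with \<open>prime p\<close> have "p > 3" using prime_ge_2_int[of p] by auto
  moreover have "QuadRes p 3"
    using \<open>p dvd d\<close> assms(1) dvd_trans by (auto simp: QuadRes_def cong_iff_dvd_diff)
  ultimately show "cong_pm1 12 p"
    using QuadRes_3_iff_cong_pm1_12[of "nat p"] \<open>prime p\<close> by simp
qed

lemma integral_points_E_x_cong_1_mod_4:
  assumes "(a, b) \<in> integral_points (E k)"
  shows "[a = 1] (mod 4)"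
proof -
  have "[(b mod 4)\<^sup>2 - (k mod 4) * (a mod 4) * (b mod 4) = b\<^sup>2 - k * a * b] (mod 4)"
    by (intro cong_diff cong_mult cong_pow cong_mod_leftI cong_refl)
  also have "b\<^sup>2 - k * a * b = a^3 - (k\<^sup>2 + 5)"
    using assms by (simp only: integral_points_E_iff)
  also have "[\<dots> = (a mod 4)^3 - ((k mod 4)\<^sup>2 + 5)] (mod 4)"
    by (intro cong_diff cong_add cong_pow cong_mod_rightI cong_refl)
  finally have "[(b mod 4)\<^sup>2 - (k mod 4) * (a mod 4) * (b mod 4)
      = (a mod 4)^3 - ((k mod 4)\<^sup>2 + 5)] (mod 4)" .
  moreover have "r mod 4 = 0 \<or> r mod 4 = 1 \<or> r mod 4 = 2 \<or> r mod 4 = 3" for r :: int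
    by presburger
  note this[of a] this[of b] this[of k]
  ultimately show ?thesis unfolding cong_def by (elim disjE) simp_all
qed

lemma integral_points_E_factorization:
  assumes "(a, b) \<in> integral_points (E k)"
  shows "(b - k)\<^sup>2 - 3 = (a - 2) * (b * k + a\<^sup>2 + 2 * a + 4)"
  using assms
  by (simp add: integral_points_E_iff algebra_simps power2_eq_square power3_eq_cube)

lemma integral_points_E_divisor_cong:
  assumes "(a, b) \<in> integral_points (E k)" "d dvd a - 2" "\<not> 3 dvd d"
  shows "[d = 1] (mod 3) \<longleftrightarrow> [d = 1] (mod 4)"
proof -
  have "odd (a - 2)"
    using integral_points_E_x_cong_1_mod_4[OF assms(1)] unfolding cong_iff_dvd_diff by presburger
  then have "coprime d 6"
    using assms(2,3) dvd_trans coprime_6_iff by blast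
  moreover have "d dvd (b - k)\<^sup>2 - 3"
    using assms(2) by (simp add: integral_points_E_factorization[OF assms(1)])
  ultimately show ?thesis
    using cong_pm1_12_if_dvd_square_minus_3 cong_pm1_12_iff by blast
qed

lemma integral_points_E_x_not_cong_1_mod_3:
  assumes "(a, b) \<in> integral_points (E k)"
  shows "\<not> [a = 1] (mod 3)"
proof
  assume "[a = 1] (mod 3)"
  then have "[b * k * (a + 2) + (a^3 - 5) = b * k * (1 + 2) + (1^3 - 5)] (mod 3)"
    by (intro cong_add cong_diff cong_mult cong_pow cong_refl)
  also have "b * k * (a + 2) + (a^3 - 5) = (b + k)\<^sup>2"
    using assms by (simp add: integral_points_E_iff algebra_simps power2_eq_square)
  also have "[b * k * (1 + 2) + (1^3 - 5) = 2] (mod 3)"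
    by (simp add: cong_iff_dvd_diff)
  finally have "[(b + k)\<^sup>2 = 2] (mod 3)" .
  then have "QuadRes 3 2" unfolding QuadRes_def by blast
  then show False by (simp add: QuadRes_mod_3_iff)
qed

lemma integral_points_E_3_dvd_x_minus_2:
  assumes "(a, b) \<in> integral_points (E k)"
  shows "3 dvd a - 2"
proof (rule ccontr)
  assume "\<not> 3 dvd a - 2"
  then have "[a - 2 = 1] (mod 3) \<longleftrightarrow> [a - 2 = 1] (mod 4)"
    by (rule integral_points_E_divisor_cong[OF assms dvd_refl])
  with \<open>\<not> 3 dvd a - 2\<close> integral_points_E_x_cong_1_mod_4[OF assms] have "[a = 1] (mod 3)"
    unfolding cong_iff_dvd_diff by presburger
  with integral_points_E_x_not_cong_1_mod_3[OF assms] show False ..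
qed

lemma integral_points_E_x_cofactor_cong_2_mod_3:
  assumes "(3 * m + 2, b) \<in> integral_points (E k)"
  shows "[m = 2] (mod 3)"
proof -
  define c where "c = b * k + (3 * m + 2)\<^sup>2 + 2 * (3 * m + 2) + 4"
  have square_eq: "(b - k)\<^sup>2 = 3 * (m * c + 1)"
    using integral_points_E_factorization[OF assms] by (simp add: c_def)
  then have "3 dvd b - k"
    using prime_dvd_power[of "3 :: int" "b - k" 2] by simp
  then obtain n where "b - k = 3 * n" by (rule dvdE)
  with square_eq have "m * c + 1 = 3 * n\<^sup>2" by (simp add: power_mult_distrib)
  have c_cong: "[c = k\<^sup>2] (mod 3)"
  proof -
    have "c - k\<^sup>2 = k * (b - k) + 3 * (3 * m\<^sup>2 + 6 * m + 4)"
      by (simp add: c_def algebra_simps power2_eq_square)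
    with \<open>3 dvd b - k\<close> show ?thesis by (simp add: cong_iff_dvd_diff)
  qed
  have "[(m mod 3) * (k mod 3)\<^sup>2 + 1 = m * k\<^sup>2 + 1] (mod 3)"
    by (intro cong_add cong_mult cong_pow cong_mod_leftI cong_refl)
  also have "[m * k\<^sup>2 + 1 = m * c + 1] (mod 3)"
    by (intro cong_add cong_mult cong_refl cong_sym[OF c_cong])
  also have "[m * c + 1 = 0] (mod 3)"
    by (simp add: \<open>m * c + 1 = 3 * n\<^sup>2\<close> cong_0_iff)
  finally have "[(m mod 3) * (k mod 3)\<^sup>2 + 1 = 0] (mod 3)" .
  moreover have "r mod 3 = 0 \<or> r mod 3 = 1 \<or> r mod 3 = 2" for r :: int
    by presburger
  note this[of k] this[of m]
  ultimately show ?thesis unfolding cong_def by (elim disjE) simp_all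
qed

theorem theorem1p2:
  fixes k :: int
  shows "integral_points (E k) = {}"
proof -
  have False if point: "(a, b) \<in> integral_points (E k)" for a b
  proof -
    obtain m where "a - 2 = 3 * m"
      using integral_points_E_3_dvd_x_minus_2[OF point] by (rule dvdE)
    then have a_eq: "a = 3 * m + 2" by simp
    have m_mod_3: "[m = 2] (mod 3)"
      using point unfolding a_eq by (rule integral_points_E_x_cofactor_cong_2_mod_3)
    have m_mod_4: "[m = 1] (mod 4)"
      using integral_points_E_x_cong_1_mod_4[OF point] unfolding a_eq cong_iff_dvd_diff
      by presburger
    have "\<not> 3 dvd m"
      using m_mod_3 by (simp add: cong_dvd_iff)
    then have "[m = 1] (mod 3) \<longleftrightarrow> [m = 1] (mod 4)"
      using integral_points_E_divisor_cong[OF point] by (simp add: a_eq)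
    with m_mod_3 m_mod_4 show False by (simp add: cong_def)
  qed
  then show ?thesis by auto
qed

end
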